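(* For every integer $k \geq 1$ there exists a constant $c_k$, depending only on $k$, such that for every positive integer $n$ and every $k$-dimensional cellular $\mathbb{Z}_2$-cycle $z \in Z_k Q_n$ in the $n$-dimensional cube $Q_n$, there exists a chain $y \in C_{k+1} Q_n$ such that $\partial y = z$ and $$\lVert y \rVert \leq c_k \lVert z \rVert^{\frac{k+1}{k}}.$$
   Context: $Q_n$ denotes the $n$-dimensional cube, regarded as a cell complex whose $k$-dimensional faces are the strings of length $n$ over $\{0,1,*\}$ with exactly $k$ entries equal to $*$ (the indeterminate, or varying, coordinates). $Q_n^{(k)}$ is the set of $k$-dimensional faces, so $|Q_n^{(k)}| = 2^{n-k}\binom{n}{k}$ for $0 \leq k \leq n$, and $Q_n^{(k)}$ is empty for $k>n$. The space of $k$-chains is $C_k Q_n = \{\text{functions } Q_n^{(k)} \to \mathbb{Z}_2\}$, where $\mathbb{Z}_2 = \mathbb{Z}/2\mathbb{Z}$. The boundary map $\partial : C_k Q_n \to C_{k-1} Q_n$ is the $\mathbb{Z}_2$-linear map sending a single $k$-face to the sum of the $2k$ $(k-1)$-faces obtained by replacing one of its $k$ entries $*$ by $0$ or by $1$. The space of $k$-cycles is $Z_k Q_n = \ker(\partial : C_k Q_n \to C_{k-1} Q_n)$. The norm is the Hamming norm $\lVert y \rVert = |\operatorname{supp} y|$, the number of faces on which $y$ is nonzero. *)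

theory Defs
  imports Complex_Main "HOL-Library.Z2"
begin

datatype coord = C0 | C1 | Star

type_synonym face = "coord list"

definition stars :: "face \<Rightarrow> nat set" where
  "stars F = {i. i < length F \<and> F ! i = Star}"

definition cube_faces :: "nat \<Rightarrow> nat \<Rightarrow> face set" where
  "cube_faces n k = {F. length F = n \<and> card (stars F) = k}"

text \<open>A chain is a function on the \<open>k\<close>-faces; it is represented by its extension by zero to
  all strings, so that equality of chains is equality of functions.\<close>

definition cube_chains :: "nat \<Rightarrow> nat \<Rightarrow> (face \<Rightarrow> bit) set" where
  "cube_chains n k = {y. \<forall>F. F \<notin> cube_faces n k \<longrightarrow> y F = 0}"

definition face_chain :: "face \<Rightarrow> face \<Rightarrow> bit" where
  "face_chain F = (\<lambda>G. if G = F then 1 else 0)"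

definition face_boundary :: "face \<Rightarrow> face \<Rightarrow> bit" where
  "face_boundary F = (\<lambda>G. \<Sum>i\<in>stars F. \<Sum>b\<in>{C0, C1}. face_chain (F[i := b]) G)"

definition cube_boundary :: "nat \<Rightarrow> nat \<Rightarrow> (face \<Rightarrow> bit) \<Rightarrow> (face \<Rightarrow> bit)" where
  "cube_boundary n k y = (\<lambda>G. \<Sum>F\<in>cube_faces n k. y F * face_boundary F G)"

definition cube_cycles :: "nat \<Rightarrow> nat \<Rightarrow> (face \<Rightarrow> bit) set" where
  "cube_cycles n k = {z \<in> cube_chains n k. cube_boundary n k z = (\<lambda>_. 0)}"

definition hamming_norm :: "(face \<Rightarrow> bit) \<Rightarrow> nat" where
  "hamming_norm y = card {F. y F \<noteq> 0}"

end

theory Submission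
  imports Defs
begin

text \<open>
  Induction on the dimension \<open>n\<close> of the cube. The first coordinate splits a \<open>k\<close>-cycle \<open>z\<close> into the
  parts \<open>z\<^sub>0\<close>, \<open>z\<^sub>1\<close> on the two opposite facets and the part \<open>p \<times> I\<close> between them, where \<open>p\<close> is a
  \<open>(k-1)\<close>-cycle and \<open>\<partial>z\<^sub>0 = \<partial>z\<^sub>1 = p\<close>. For any \<open>w\<close> with \<open>\<partial>w = p\<close>, fillings of the cycles \<open>z\<^sub>0 + w\<close>
  and \<open>z\<^sub>1 + w\<close> in the facets together with \<open>w \<times> I\<close> fill \<open>z\<close>.
  Write \<open>m\<close> for the smaller of the norms of \<open>z\<^sub>0\<close> and \<open>z\<^sub>1\<close>, and \<open>N\<close> for the norm of \<open>z\<close>.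
  If \<open>m \<le> D \<parallel>p\<parallel> N\<^bsup>1/k\<^esup>\<close>, take \<open>w\<close> to be the smaller of \<open>z\<^sub>0\<close> and \<open>z\<^sub>1\<close>, i.e. project \<open>z\<close> to a facet: the
  cost \<open>m\<close> of \<open>w \<times> I\<close> is paid for by the disappearance of \<open>p\<close>. Otherwise \<open>p\<close> is so small that, by
  the inequality for \<open>k - 1\<close> (and because \<open>p = 0\<close> when \<open>k = 1\<close>), it has a filling \<open>w\<close> of norm at most \<open>\<epsilon> m\<close>, and the strict
  superadditivity of \<open>x \<mapsto> x\<^bsup>1 + 1/k\<^esup>\<close> absorbs the added \<open>w\<close>'s. Neither \<open>D\<close> nor \<open>\<epsilon>\<close> depends on \<open>n\<close>.
\<close>

text \<open>These rules rewrite sums and products of bits to bit operations, out of reach of the ring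
  and big-operator lemmas.\<close>

declare add_bit_eq_xor [simp del] mult_bit_eq_and [simp del]

lemma bit_add_eq_0_iff: "(x::bit) + y = 0 \<longleftrightarrow> x = y"
  by (cases x; cases y) auto

section \<open>Faces, chains and the boundary map, split along the first coordinate\<close>

lemma finite_stars: "finite (stars F)"
  by (simp add: stars_def)

lemma stars_Nil: "stars [] = {}"
  by (simp add: stars_def)

lemma stars_Cons:
  "stars (c # F) = (if c = Star then insert 0 (Suc ` stars F) else Suc ` stars F)"
proof (rule set_eqI)
  fix i
  show "i \<in> stars (c # F) \<longleftrightarrow>
      i \<in> (if c = Star then insert 0 (Suc ` stars F) else Suc ` stars F)"
    by (cases i) (auto simp: stars_def)
qed

lemma card_stars_Cons: "card (stars (c # F)) = (if c = Star then 1 else 0) + card (stars F)"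
  by (simp add: stars_Cons finite_stars card_image)

lemma cube_faces_0_Suc: "cube_faces 0 (Suc k) = {}"
  by (auto simp: cube_faces_def stars_Nil)

lemma Cons_in_cube_faces_iff:
  "c # F \<in> cube_faces (Suc n) (Suc k) \<longleftrightarrow> F \<in> cube_faces n (if c = Star then k else Suc k)"
  by (auto simp: cube_faces_def card_stars_Cons)

lemma cube_faces_Suc:
  "cube_faces (Suc n) (Suc k) =
     (#) C0 ` cube_faces n (Suc k) \<union> (#) C1 ` cube_faces n (Suc k) \<union> (#) Star ` cube_faces n k"
  (is "_ = ?R")
proof (rule set_eqI)
  fix G
  show "G \<in> cube_faces (Suc n) (Suc k) \<longleftrightarrow> G \<in> ?R"
  proof (cases G)
    case Nil
    then show ?thesis by (auto simp: cube_faces_def)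
  next
    case (Cons c F)
    then show ?thesis by (cases c) (auto simp: Cons_in_cube_faces_iff)
  qed
qed

lemma finite_cube_faces: "finite (cube_faces n k)"
proof -
  have "finite {F. set F \<subseteq> {C0, C1, Star} \<and> length F = n}"
    by (rule finite_lists_length_eq) simp
  moreover have "x \<in> {C0, C1, Star}" for x
    by (cases x) auto
  then have "cube_faces n k \<subseteq> {F. set F \<subseteq> {C0, C1, Star} \<and> length F = n}"
    by (auto simp: cube_faces_def)
  ultimately show ?thesis by (rule finite_subset[rotated])
qed

lemma sum_cube_faces_Suc:
  fixes f :: "face \<Rightarrow> 'a::comm_monoid_add"
  shows "sum f (cube_faces (Suc n) (Suc k)) =
    (\<Sum>F\<in>cube_faces n (Suc k). f (C0 # F)) + (\<Sum>F\<in>cube_faces n (Suc k). f (C1 # F)) +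
    (\<Sum>F\<in>cube_faces n k. f (Star # F))"
proof -
  have inj: "sum f ((#) c ` A) = (\<Sum>F\<in>A. f (c # F))" for c A
    by (simp add: sum.reindex)
  have un: "sum f (A \<union> B \<union> C) = sum f A + sum f B + sum f C"
    if "finite A" "finite B" "finite C" "A \<inter> B = {}" "(A \<union> B) \<inter> C = {}" for A B C
    using that sum.union_disjoint[of "A \<union> B" C f] sum.union_disjoint[of A B f] by simp
  have "sum f (cube_faces (Suc n) (Suc k)) =
      sum f ((#) C0 ` cube_faces n (Suc k)) + sum f ((#) C1 ` cube_faces n (Suc k)) +
      sum f ((#) Star ` cube_faces n k)"
    unfolding cube_faces_Suc by (rule un) (auto simp: finite_cube_faces)
  then show ?thesis
    unfolding inj .
qed

text \<open>Product formula for the boundary of a cell: replacing a star of the tail keeps the first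
  coordinate, while replacing a leading \<open>Star\<close> leaves the tail \<open>F\<close> once in
  each of the two facets.\<close>

lemma face_boundary_Cons:
  "face_boundary (c # F) (d # G) =
     (if c = d then face_boundary F G else if c = Star then face_chain F G else 0)"
proof -
  have 1: "(\<Sum>i\<in>Suc ` stars F. \<Sum>b\<in>{C0, C1}. face_chain ((c # F)[i := b]) (d # G)) =
      (if c = d then face_boundary F G else 0)"
    by (auto simp: sum.reindex face_boundary_def face_chain_def)
  have 2: "(\<Sum>b\<in>{C0, C1}. face_chain ((c # F)[0 := b]) (d # G)) =
      (if d = Star then 0 else face_chain F G)"
    by (cases d) (auto simp: face_chain_def)
  show ?thesis
    unfolding face_boundary_def[of "c # F"] stars_Cons
    using 1 2 by (auto simp: finite_stars)
qed

lemma face_boundary_Cons_Nil: "face_boundary (c # F) [] = 0"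
proof -
  have "[] \<noteq> (c # F)[i := b]" for i b
    by (metis length_list_update list.distinct(1) list.size(3) length_0_conv)
  then show ?thesis by (simp add: face_boundary_def face_chain_def)
qed

lemma cube_boundary_add:
  "cube_boundary n k (\<lambda>F. x F + y F) = (\<lambda>G. cube_boundary n k x G + cube_boundary n k y G)"
  by (simp add: cube_boundary_def distrib_right sum.distrib)

lemma cube_boundary_zero: "cube_boundary n k (\<lambda>F. 0) = (\<lambda>G. 0)"
  by (simp add: cube_boundary_def)

lemma sum_face_chain:
  assumes "y \<in> cube_chains n k"
  shows "(\<Sum>F\<in>cube_faces n k. y F * face_chain F G) = y G"
proof -
  have "(\<Sum>F\<in>cube_faces n k. y F * face_chain F G) =
      (\<Sum>F\<in>cube_faces n k. if G = F then y F else 0)"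
    by (rule sum.cong) (auto simp: face_chain_def)
  also have "\<dots> = y G"
    using assms by (auto simp: finite_cube_faces cube_chains_def)
  finally show ?thesis .
qed

text \<open>For \<open>c = Star\<close> the dimension of the chain drops by one: the result is the
  cross-section of the part of \<open>y\<close> between the two facets.\<close>

definition slice :: "coord \<Rightarrow> (face \<Rightarrow> bit) \<Rightarrow> face \<Rightarrow> bit" where
  "slice c y F = y (c # F)"

lemma slice_in_cube_chains:
  assumes "y \<in> cube_chains (Suc n) (Suc k)"
  shows "slice c y \<in> cube_chains n (if c = Star then k else Suc k)"
  using assms by (simp add: cube_chains_def slice_def Cons_in_cube_faces_iff)

lemma cube_chains_Nil: "y \<in> cube_chains (Suc n) k \<Longrightarrow> y [] = 0"
  by (auto simp: cube_chains_def cube_faces_def)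

lemma cube_boundary_Nil: "cube_boundary (Suc n) (Suc k) y [] = 0"
  by (simp add: cube_boundary_def sum_cube_faces_Suc face_boundary_Cons_Nil)

text \<open>Both endpoints of the interval contribute, so the cross-section
  \<open>slice Star y\<close> enters the boundary over \<open>C0\<close> and over \<open>C1\<close>
  alike.\<close>

lemma cube_boundary_Cons:
  assumes "y \<in> cube_chains (Suc n) (Suc k)"
  shows "cube_boundary (Suc n) (Suc k) y (d # G) =
    (if d = Star then cube_boundary n k (slice Star y) G
     else cube_boundary n (Suc k) (slice d y) G + slice Star y G)"
  using sum_face_chain[OF slice_in_cube_chains[OF assms, of Star, simplified]]
  by (cases d) (simp_all add: cube_boundary_def sum_cube_faces_Suc face_boundary_Cons slice_def)

section \<open>Hamming norms of slices and of sums\<close>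

lemma hamming_norm_eq_sum_slices:
  assumes "y \<in> cube_chains (Suc n) (Suc k)"
  shows "hamming_norm y =
    hamming_norm (slice C0 y) + hamming_norm (slice C1 y) + hamming_norm (slice Star y)"
proof -
  have norm_eq: "hamming_norm x = (\<Sum>F\<in>cube_faces m j. if x F \<noteq> 0 then 1 else 0)"
    if "x \<in> cube_chains m j" for x m j
  proof -
    have "{F. x F \<noteq> 0} = {F \<in> cube_faces m j. x F \<noteq> 0}"
      using that by (auto simp: cube_chains_def)
    then show ?thesis
      by (simp only: hamming_norm_def card_eq_sum sum.inter_filter[OF finite_cube_faces])
  qed
  show ?thesis
    unfolding norm_eq[OF assms] sum_cube_faces_Suc
      norm_eq[OF slice_in_cube_chains[OF assms, of C0]]
      norm_eq[OF slice_in_cube_chains[OF assms, of C1]]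
      norm_eq[OF slice_in_cube_chains[OF assms, of Star]]
    by (simp add: slice_def)
qed

lemma hamming_norm_add_le:
  assumes "x \<in> cube_chains n k" "y \<in> cube_chains n k"
  shows "hamming_norm (\<lambda>F. x F + y F) \<le> hamming_norm x + hamming_norm y"
proof -
  have fin: "finite {F. u F \<noteq> 0}" if "u \<in> cube_chains n k" for u
    by (rule finite_subset[OF _ finite_cube_faces[of n k]]) (use that in \<open>auto simp: cube_chains_def\<close>)
  have "hamming_norm (\<lambda>F. x F + y F) \<le> card ({F. x F \<noteq> 0} \<union> {F. y F \<noteq> 0})"
    unfolding hamming_norm_def by (rule card_mono) (use fin assms in auto)
  also have "\<dots> \<le> hamming_norm x + hamming_norm y"
    unfolding hamming_norm_def by (rule card_Un_le)
  finally show ?thesis .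
qed

lemma hamming_norm_zero: "hamming_norm (\<lambda>F. 0) = 0"
  by (simp add: hamming_norm_def)

lemma hamming_norm_eq_0_iff:
  assumes "y \<in> cube_chains n k"
  shows "hamming_norm y = 0 \<longleftrightarrow> y = (\<lambda>F. 0)"
proof -
  have "finite {F. y F \<noteq> 0}"
    by (rule finite_subset[OF _ finite_cube_faces[of n k]])
      (use assms in \<open>auto simp: cube_chains_def\<close>)
  then show ?thesis by (auto simp: hamming_norm_def)
qed

lemma add_in_cube_chains:
  "x \<in> cube_chains n k \<Longrightarrow> y \<in> cube_chains n k \<Longrightarrow> (\<lambda>F. x F + y F) \<in> cube_chains n k"
  by (simp add: cube_chains_def)

lemma zero_in_cube_chains: "(\<lambda>F. 0) \<in> cube_chains n k"
  by (simp add: cube_chains_def)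

text \<open>Faces over \<open>C0\<close>, \<open>C1\<close> and \<open>Star\<close> in the first coordinate carry \<open>x\<close>, \<open>y\<close> and the
  product of \<open>w\<close> with the unit interval.\<close>

definition join :: "(face \<Rightarrow> bit) \<Rightarrow> (face \<Rightarrow> bit) \<Rightarrow> (face \<Rightarrow> bit) \<Rightarrow> face \<Rightarrow> bit" where
  "join x y w G = (case G of [] \<Rightarrow> 0 | c # F \<Rightarrow> (case c of C0 \<Rightarrow> x F | C1 \<Rightarrow> y F | Star \<Rightarrow> w F))"

lemma slice_join: "slice C0 (join x y w) = x" "slice C1 (join x y w) = y" "slice Star (join x y w) = w"
  by (auto simp: slice_def join_def)

lemma join_in_cube_chains:
  assumes "x \<in> cube_chains n (Suc k)" "y \<in> cube_chains n (Suc k)" "w \<in> cube_chains n k"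
  shows "join x y w \<in> cube_chains (Suc n) (Suc k)"
  using assms
  by (auto simp: cube_chains_def join_def Cons_in_cube_faces_iff split: list.splits coord.splits)

section \<open>Slices of cycles, and gluing of fillings in the two facets\<close>

lemma cycle_slices:
  assumes z: "z \<in> cube_cycles (Suc n) (Suc k)"
  shows "slice Star z \<in> cube_cycles n k"
    and "c \<noteq> Star \<Longrightarrow> cube_boundary n (Suc k) (slice c z) = slice Star z"
proof -
  have ch: "z \<in> cube_chains (Suc n) (Suc k)"
    and b: "cube_boundary (Suc n) (Suc k) z (d # G) = 0" for d G
    using z by (auto simp: cube_cycles_def)
  show "slice Star z \<in> cube_cycles n k"
    using slice_in_cube_chains[OF ch, of Star] b[of Star]
    by (auto simp: cube_cycles_def cube_boundary_Cons[OF ch])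
  show "cube_boundary n (Suc k) (slice c z) = slice Star z" if "c \<noteq> Star"
    using b[of c] that by (auto simp: cube_boundary_Cons[OF ch] bit_add_eq_0_iff fun_eq_iff)
qed

lemma slice_add_in_cube_cycles:
  assumes z: "z \<in> cube_cycles (Suc n) (Suc k)" and "c \<noteq> Star"
    and w: "w \<in> cube_chains n (Suc k)" "cube_boundary n (Suc k) w = slice Star z"
  shows "(\<lambda>F. slice c z F + w F) \<in> cube_cycles n (Suc k)"
proof -
  have "slice c z \<in> cube_chains n (Suc k)"
    using slice_in_cube_chains[of z n k c] z \<open>c \<noteq> Star\<close> by (simp add: cube_cycles_def)
  then show ?thesis
    using cycle_slices(2)[OF z \<open>c \<noteq> Star\<close>] w
    by (simp add: cube_cycles_def add_in_cube_chains cube_boundary_add)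
qed

text \<open>Over \<open>C0\<close> and over \<open>C1\<close>, the \<open>w\<close> in the boundary
  of \<open>x\<close> or \<open>y\<close> cancels modulo 2 against the end of the product of
  \<open>w\<close> with the interval.\<close>

lemma cube_boundary_join:
  assumes z: "z \<in> cube_cycles (Suc n) (Suc k)"
    and w: "w \<in> cube_chains n (Suc k)" "cube_boundary n (Suc k) w = slice Star z"
    and x: "x \<in> cube_chains n (Suc (Suc k))"
      "cube_boundary n (Suc (Suc k)) x = (\<lambda>F. slice C0 z F + w F)"
    and y: "y \<in> cube_chains n (Suc (Suc k))"
      "cube_boundary n (Suc (Suc k)) y = (\<lambda>F. slice C1 z F + w F)"
  shows "cube_boundary (Suc n) (Suc (Suc k)) (join x y w) = z"
proof
  fix G
  have j: "join x y w \<in> cube_chains (Suc n) (Suc (Suc k))"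
    using x y w by (simp add: join_in_cube_chains)
  show "cube_boundary (Suc n) (Suc (Suc k)) (join x y w) G = z G"
  proof (cases G)
    case Nil
    then show ?thesis
      using z cube_chains_Nil by (auto simp: cube_boundary_Nil cube_cycles_def)
  next
    case (Cons d F)
    then show ?thesis
      by (cases d) (simp_all add: cube_boundary_Cons[OF j] slice_join w x y slice_def add.assoc)
  qed
qed

section \<open>Superadditivity estimates for the power \<open>1 + \<alpha>\<close>\<close>

lemma powr_add_split:
  fixes a b t \<alpha> c :: real
  assumes "1 \<le> b" "b \<le> a" "0 < \<alpha>" "1 \<le> c" "0 \<le> t"
    and t: "t \<le> (1 - (3/4) powr \<alpha>) / 3 * b"
  shows "c * (a + t) powr (1 + \<alpha>) + c * (b + t) powr (1 + \<alpha>) + t \<le> c * (a + b) powr (1 + \<alpha>)"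
proof -
  define \<theta> :: real where "\<theta> = (3/4) powr \<alpha>"
  define M where "M = (a + b) powr \<alpha>"
  have \<theta>: "0 < \<theta>" "\<theta> < 1"
    using \<open>0 < \<alpha>\<close> powr_less_mono2[of \<alpha> "3/4" 1] by (auto simp: \<theta>_def)
  have "(1 - \<theta>) / 3 * b \<le> 1 / 3 * b"
    using \<theta> assms by (intro mult_right_mono) auto
  then have t3: "t \<le> b / 3"
    using t by (simp add: \<theta>_def)
  have M: "1 \<le> M"
    using assms by (simp add: M_def ge_one_powr_ge_zero)
  have pow: "x powr (1 + \<alpha>) = x * x powr \<alpha>" if "0 < x" for x :: real
    using that by (simp add: powr_add)
  have A: "(a + t) powr (1 + \<alpha>) \<le> (a + t) * M"
    unfolding M_def using assms t3 by (subst pow) (auto intro!: mult_left_mono powr_mono2)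
  \<comment> \<open>Here \<open>b + t\<close> is at most \<open>4/3 * b\<close>, hence at most
    \<open>3/4 * (a + b)\<close>; this fixed ratio below 1 gains the factor \<open>\<theta>\<close>
    over \<open>M\<close>.\<close>
  have "(b + t) powr \<alpha> \<le> (3/4 * (a + b)) powr \<alpha>"
    using assms t3 by (intro powr_mono2) auto
  also have "\<dots> = \<theta> * M"
    using powr_mult[of "3/4" "a + b" \<alpha>] assms by (simp add: \<theta>_def M_def)
  finally have B: "(b + t) powr (1 + \<alpha>) \<le> (b + t) * (\<theta> * M)"
    using assms by (subst pow) (auto intro!: mult_left_mono)
  have "\<theta> * t \<le> t"
    using \<theta> assms by (simp add: mult_left_le_one_le)
  \<comment> \<open>This amounts to \<open>(2 + \<theta>) * t \<le> (1 - \<theta>) * b\<close>,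
    whence the 3 in the bound on \<open>t\<close>.\<close>
  then have key: "(a + t) + (b + t) * \<theta> + t \<le> a + b"
    using t by (simp add: \<theta>_def[symmetric] algebra_simps)
  \<comment> \<open>As \<open>c * M\<close> is at least 1, the lone \<open>t\<close> can be charged
    at the same rate as the other terms.\<close>
  have "1 * t \<le> (c * M) * t"
    using M assms by (intro mult_right_mono) (auto intro: mult_ge1_I)
  then have "c * (a + t) powr (1 + \<alpha>) + c * (b + t) powr (1 + \<alpha>) + t
      \<le> c * ((a + t) * M) + c * ((b + t) * (\<theta> * M)) + (c * M) * t"
    using A B assms by (intro add_mono mult_left_mono) auto
  also have "\<dots> = (c * M) * ((a + t) + (b + t) * \<theta> + t)"
    by (simp add: algebra_simps)
  also have "\<dots> \<le> (c * M) * (a + b)"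
    using key M assms by (intro mult_left_mono) auto
  also have "\<dots> = c * (a + b) powr (1 + \<alpha>)"
    using assms by (subst pow) (auto simp: M_def)
  finally show ?thesis .
qed

text \<open>Since \<open>s powr (1 + \<alpha>)\<close> is at most
  \<open>s * (s + p) powr \<alpha>\<close>, the right side has at least
  \<open>c * p * (s + p) powr \<alpha>\<close> to spare for \<open>b\<close>.\<close>

lemma powr_drop_le:
  fixes s p b \<alpha> c :: real
  assumes "0 \<le> s" "0 \<le> p" "0 < \<alpha>" "b \<le> c * p * (s + p) powr \<alpha>" "0 \<le> c"
  shows "c * s powr (1 + \<alpha>) + b \<le> c * (s + p) powr (1 + \<alpha>)"
proof -
  have pow: "x powr (1 + \<alpha>) = x * x powr \<alpha>" if "0 \<le> x" for x :: real
    using that \<open>0 < \<alpha>\<close> by (cases "x = 0") (auto simp: powr_add)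
  have "s powr (1 + \<alpha>) \<le> s * (s + p) powr \<alpha>"
    using assms by (subst pow) (auto intro!: mult_left_mono powr_mono2)
  then have "c * s powr (1 + \<alpha>) \<le> c * (s * (s + p) powr \<alpha>)"
    using assms by (intro mult_left_mono)
  then show ?thesis
    using assms by (subst (2) pow) (auto simp: algebra_simps)
qed

section \<open>Filling inequalities with constants uniform in \<open>n\<close>\<close>

definition filling_bound :: "nat \<Rightarrow> real \<Rightarrow> bool" where
  "filling_bound k c \<longleftrightarrow> (\<forall>n. \<forall>z\<in>cube_cycles n k. \<exists>y\<in>cube_chains n (Suc k).
     cube_boundary n (Suc k) y = z \<and>
     real (hamming_norm y) \<le> c * real (hamming_norm z) powr (1 + 1 / real k))"


text \<open>The induction on \<open>n\<close>. All it asks of dimension \<open>k\<close> is isolated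
  in \<open>small\<close>, so that it serves both \<open>k = 0\<close>, where \<open>p\<close> is
  forced to vanish, and \<open>k \<ge> 1\<close>, where a filling inequality for \<open>k\<close> is
  at hand.\<close>

lemma filling_bound_Suc:
  fixes k :: nat and D :: real
  defines "\<alpha> \<equiv> 1 / real (Suc k)"
  assumes small: "\<And>n p b N. p \<in> cube_cycles n k \<Longrightarrow> b \<le> N \<Longrightarrow>
      D * real (hamming_norm p) * N powr \<alpha> < b \<Longrightarrow>
      \<exists>w\<in>cube_chains n (Suc k). cube_boundary n (Suc k) w = p \<and>
        real (hamming_norm w) \<le> (1 - (3/4) powr \<alpha>) / 3 * b"
    and "0 \<le> D"
  shows "filling_bound (Suc k) (max 1 D)"
proof -
  define c where "c = max 1 D"
  have c: "1 \<le> c" "D \<le> c" by (auto simp: c_def)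
  have \<alpha>: "0 < \<alpha>" by (simp add: \<alpha>_def)
  have "\<exists>y\<in>cube_chains n (Suc (Suc k)). cube_boundary n (Suc (Suc k)) y = z \<and>
      real (hamming_norm y) \<le> c * real (hamming_norm z) powr (1 + \<alpha>)"
    if "z \<in> cube_cycles n (Suc k)" for n z
    using that
  proof (induction n arbitrary: z)
    case 0
    then have "z = (\<lambda>F. 0)"
      by (auto simp: cube_cycles_def cube_chains_def cube_faces_0_Suc)
    then show ?case
      by (auto intro!: bexI[of _ "\<lambda>F. 0"]
          simp: zero_in_cube_chains cube_boundary_zero hamming_norm_zero)
  next
    case (Suc n)
    note z = \<open>z \<in> cube_cycles (Suc n) (Suc k)\<close>
    define z0 z1 p where "z0 = slice C0 z" and "z1 = slice C1 z" and "p = slice Star z"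
    have chain: "z0 \<in> cube_chains n (Suc k)" "z1 \<in> cube_chains n (Suc k)"
      using slice_in_cube_chains[of z n k C0] slice_in_cube_chains[of z n k C1] z
      by (auto simp: cube_cycles_def z0_def z1_def)
    have boundary: "cube_boundary n (Suc k) z0 = p" "cube_boundary n (Suc k) z1 = p"
      using cycle_slices(2)[OF z] by (auto simp: z0_def z1_def p_def)
    have p: "p \<in> cube_cycles n k"
      using cycle_slices(1)[OF z] by (simp add: p_def)
    define a b q where "a = real (hamming_norm z0)" and "b = real (hamming_norm z1)"
      and "q = real (hamming_norm p)"
    have nonneg: "0 \<le> a" "0 \<le> b" "0 \<le> q"
      by (auto simp: a_def b_def q_def)
    have N: "real (hamming_norm z) = a + b + q"
      using z hamming_norm_eq_sum_slices[of z n k]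
      by (simp add: cube_cycles_def a_def b_def q_def z0_def z1_def p_def)
    \<comment> \<open>By the induction hypothesis, \<open>?f w\<close> bounds the norm of a filling
      of \<open>z\<close> glued along \<open>w\<close>; what matters is the choice of
      \<open>w\<close>.\<close>
    have "\<exists>w\<in>cube_chains n (Suc k). cube_boundary n (Suc k) w = p \<and>
        c * real (hamming_norm (\<lambda>F. z0 F + w F)) powr (1 + \<alpha>) +
        c * real (hamming_norm (\<lambda>F. z1 F + w F)) powr (1 + \<alpha>) + real (hamming_norm w)
        \<le> c * (a + b + q) powr (1 + \<alpha>)"
      (is "\<exists>w\<in>_. _ \<and> ?f w \<le> _")
    proof (cases "min a b \<le> D * q * (a + b + q) powr \<alpha>")
      case True
      have le: "c * (a + b) powr (1 + \<alpha>) + min a b \<le> c * (a + b + q) powr (1 + \<alpha>)"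
      proof (rule powr_drop_le)
        have "D * q * (a + b + q) powr \<alpha> \<le> c * q * (a + b + q) powr \<alpha>"
          using c nonneg by (intro mult_right_mono) auto
        then show "min a b \<le> c * q * (a + b + q) powr \<alpha>"
          using True by linarith
      qed (use c \<alpha> nonneg in auto)
      have sum: "real (hamming_norm (\<lambda>F. z0 F + z1 F)) \<le> a + b"
        using hamming_norm_add_le[OF chain] by (simp add: a_def b_def flip: of_nat_add)
      have sum': "real (hamming_norm (\<lambda>F. z1 F + z0 F)) \<le> a + b"
        using sum by (simp add: add.commute)
      \<comment> \<open>With \<open>w\<close> equal to \<open>z0\<close> or \<open>z1\<close>, one
        of the two cycles to be filled is zero and the other is \<open>z0 + z1\<close>.\<close>
      have self: "(\<lambda>F. u F + u F) = (\<lambda>F. 0)" for u :: "face \<Rightarrow> bit"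
        by (simp add: bit_add_eq_0_iff)
      show ?thesis
      proof (cases "a \<le> b")
        case True
        have "c * real (hamming_norm (\<lambda>F. z1 F + z0 F)) powr (1 + \<alpha>) \<le> c * (a + b) powr (1 + \<alpha>)"
          using sum' c \<alpha> by (intro mult_left_mono powr_mono2) auto
        then have "?f z0 \<le> c * (a + b + q) powr (1 + \<alpha>)"
          using le True by (simp add: self hamming_norm_zero a_def[symmetric])
        then show ?thesis using chain boundary by blast
      next
        case False
        have "c * real (hamming_norm (\<lambda>F. z0 F + z1 F)) powr (1 + \<alpha>) \<le> c * (a + b) powr (1 + \<alpha>)"
          using sum c \<alpha> by (intro mult_left_mono powr_mono2) auto
        then have "?f z1 \<le> c * (a + b + q) powr (1 + \<alpha>)"
          using le False by (simp add: self hamming_norm_zero b_def[symmetric])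
        then show ?thesis using chain boundary by blast
      qed
    next
      case False
      then have less: "D * real (hamming_norm p) * (a + b + q) powr \<alpha> < min a b"
        unfolding q_def by linarith
      have "min a b \<le> a + b + q"
        using nonneg by linarith
      from small[OF p this less]
      obtain w where w: "w \<in> cube_chains n (Suc k)" "cube_boundary n (Suc k) w = p"
        and t: "real (hamming_norm w) \<le> (1 - (3/4) powr \<alpha>) / 3 * min a b"
        by blast
      define t where "t = real (hamming_norm w)"
      have "0 \<le> D * q * (a + b + q) powr \<alpha>"
        using \<open>0 \<le> D\<close> nonneg by simp
      then have "0 < a" "0 < b"
        using False by linarith+
      \<comment> \<open>Norms are integers, so positivity gives the lower bound 1 required by
        \<open>powr_add_split\<close>.\<close>
      then have pos: "1 \<le> a" "1 \<le> b"
        by (auto simp: a_def b_def)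
      have "real (hamming_norm (\<lambda>F. z0 F + w F)) \<le> a + t"
        "real (hamming_norm (\<lambda>F. z1 F + w F)) \<le> b + t"
        using hamming_norm_add_le[OF chain(1) w(1)] hamming_norm_add_le[OF chain(2) w(1)]
        by (simp_all add: a_def b_def t_def flip: of_nat_add)
      then have "?f w \<le> c * (a + t) powr (1 + \<alpha>) + c * (b + t) powr (1 + \<alpha>) + t"
        unfolding t_def[symmetric]
        using c \<alpha> by (intro add_mono mult_left_mono powr_mono2) auto
      also have "\<dots> \<le> c * (a + b) powr (1 + \<alpha>)"
      proof (cases "a \<le> b")
        case True
        then show ?thesis
          using powr_add_split[of a b \<alpha> c t] pos \<alpha> c t by (simp add: t_def add_ac)
      next
        case False
        then show ?thesis
          using powr_add_split[of b a \<alpha> c t] pos \<alpha> c t by (simp add: t_def)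
      qed
      also have "\<dots> \<le> c * (a + b + q) powr (1 + \<alpha>)"
        using c \<alpha> nonneg by (intro mult_left_mono powr_mono2) auto
      finally show ?thesis using w by blast
    qed
    then obtain w where w: "w \<in> cube_chains n (Suc k)" "cube_boundary n (Suc k) w = slice Star z"
      and bound: "?f w \<le> c * (a + b + q) powr (1 + \<alpha>)"
      by (auto simp: p_def)
    obtain x where x: "x \<in> cube_chains n (Suc (Suc k))"
        "cube_boundary n (Suc (Suc k)) x = (\<lambda>F. slice C0 z F + w F)"
      and xle: "real (hamming_norm x) \<le> c * real (hamming_norm (\<lambda>F. z0 F + w F)) powr (1 + \<alpha>)"
      using Suc.IH[OF slice_add_in_cube_cycles[OF z, of C0 w]] w by (auto simp: z0_def)
    obtain y where y: "y \<in> cube_chains n (Suc (Suc k))"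
        "cube_boundary n (Suc (Suc k)) y = (\<lambda>F. slice C1 z F + w F)"
      and yle: "real (hamming_norm y) \<le> c * real (hamming_norm (\<lambda>F. z1 F + w F)) powr (1 + \<alpha>)"
      using Suc.IH[OF slice_add_in_cube_cycles[OF z, of C1 w]] w by (auto simp: z1_def)
    have j: "join x y w \<in> cube_chains (Suc n) (Suc (Suc k))"
      using x y w by (simp add: join_in_cube_chains)
    have "real (hamming_norm (join x y w)) \<le> c * real (hamming_norm z) powr (1 + \<alpha>)"
      using xle yle bound by (simp add: hamming_norm_eq_sum_slices[OF j] slice_join N)
    then show ?case
      using j cube_boundary_join[OF z w x y] by blast
  qed
  then show ?thesis
    by (simp add: filling_bound_def c_def \<alpha>_def)
qed

text \<open>A 0-cycle need not bound: a single vertex does not. But with \<open>D = 1\<close> a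
  nonzero \<open>p\<close> would give \<open>N < b\<close>, so only \<open>p = 0\<close> has to be
  filled.\<close>

lemma filling_bound_1: "filling_bound (Suc 0) 1"
proof -
  have "filling_bound (Suc 0) (max 1 1)"
  proof (rule filling_bound_Suc)
    fix n p and b N :: real
    assume p: "p \<in> cube_cycles n 0" and "b \<le> N"
      and b: "1 * real (hamming_norm p) * N powr (1 / real (Suc 0)) < b"
    have "0 \<le> 1 * real (hamming_norm p) * N powr (1 / real (Suc 0))"
      by simp
    then have "0 < b" using b by linarith
    have "hamming_norm p = 0"
    proof (rule ccontr)
      assume "hamming_norm p \<noteq> 0"
      then have "1 * N \<le> real (hamming_norm p) * N"
        using \<open>b \<le> N\<close> \<open>0 < b\<close> by (intro mult_right_mono) auto
      moreover have "N powr (1 / real (Suc 0)) = N"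
        using \<open>b \<le> N\<close> \<open>0 < b\<close> by simp
      ultimately show False using b \<open>b \<le> N\<close> by simp
    qed
    then have "p = (\<lambda>F. 0)"
      using p hamming_norm_eq_0_iff[of p n 0] by (simp add: cube_cycles_def)
    moreover have "(3/4 :: real) powr (1 / real (Suc 0)) \<le> 1"
      by simp
    ultimately show "\<exists>w\<in>cube_chains n (Suc 0). cube_boundary n (Suc 0) w = p \<and>
        real (hamming_norm w) \<le> (1 - (3/4) powr (1 / real (Suc 0))) / 3 * b"
      using \<open>0 < b\<close>
      by (auto intro!: bexI[of _ "\<lambda>F. 0"]
          simp: zero_in_cube_chains cube_boundary_zero hamming_norm_zero)
  qed simp
  then show ?thesis by simp
qed

lemma filling_bound_step:
  assumes k: "1 \<le> k" and C: "filling_bound k C" and "0 \<le> C"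
  shows "\<exists>c\<ge>0. filling_bound (Suc k) c"
proof -
  define \<alpha> \<beta> where "\<alpha> = 1 / real (Suc k)" and "\<beta> = 1 + 1 / real k"
  define \<epsilon> :: real where "\<epsilon> = (1 - (3/4) powr \<alpha>) / 3"
  \<comment> \<open>Chosen so that a cost of \<open>C * q powr \<beta>\<close> is at most
    \<open>\<epsilon> * (D * q powr \<beta>)\<close>.\<close>
  define D where "D = max 1 (C / \<epsilon>)"
  have \<beta>: "1 \<le> \<beta>" "\<alpha> * \<beta> = \<beta> - 1"
    using k by (auto simp: \<alpha>_def \<beta>_def field_simps)
  have "0 < \<epsilon>"
    using powr_less_mono2[of \<alpha> "3/4" 1] by (auto simp: \<epsilon>_def \<alpha>_def)
  have D: "1 \<le> D" "C \<le> \<epsilon> * D"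
    using \<open>0 < \<epsilon>\<close> by (auto simp: D_def max_def field_simps)
  have "filling_bound (Suc k) (max 1 D)"
  proof (rule filling_bound_Suc, unfold \<alpha>_def[symmetric] \<epsilon>_def[symmetric])
    fix n p and b N :: real
    assume p: "p \<in> cube_cycles n k" and "b \<le> N"
      and b: "D * real (hamming_norm p) * N powr \<alpha> < b"
    define q where "q = real (hamming_norm p)"
    have "0 \<le> D * q * N powr \<alpha>" using D by (simp add: q_def)
    then have "0 < b" using b by (simp add: q_def)
    obtain w where w: "w \<in> cube_chains n (Suc k)" "cube_boundary n (Suc k) w = p"
      and le: "real (hamming_norm w) \<le> C * q powr \<beta>"
      using C p unfolding filling_bound_def \<beta>_def q_def by blast
    \<comment> \<open>Raising to the power \<open>\<beta>\<close> turns
      \<open>b powr \<alpha>\<close> into \<open>b powr (\<beta> - 1)\<close>; cancelling it against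
      \<open>b powr \<beta>\<close> leaves a bound linear in \<open>b\<close>.\<close>
    have "(D * q * b powr \<alpha>) powr \<beta> \<le> b powr \<beta>"
    proof (rule powr_mono2)
      have "D * q * b powr \<alpha> \<le> D * q * N powr \<alpha>"
        using D \<open>0 < b\<close> \<open>b \<le> N\<close> by (intro mult_left_mono powr_mono2) (auto simp: \<alpha>_def q_def)
      then show "D * q * b powr \<alpha> \<le> b" using b by (simp add: q_def)
    qed (use \<beta> D in \<open>auto simp: q_def\<close>)
    also have "b powr \<beta> = b * b powr (\<beta> - 1)"
      using \<open>0 < b\<close> powr_add[of b 1 "\<beta> - 1"] by simp
    also have "(D * q * b powr \<alpha>) powr \<beta> = D powr \<beta> * q powr \<beta> * b powr (\<beta> - 1)"
      using D by (simp add: powr_mult powr_powr \<beta> q_def)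
    finally have "D powr \<beta> * q powr \<beta> \<le> b"
      using \<open>0 < b\<close> by simp
    moreover have "D * q powr \<beta> \<le> D powr \<beta> * q powr \<beta>"
      using D \<beta> powr_mono[of 1 \<beta> D] by (intro mult_right_mono) auto
    ultimately have "\<epsilon> * (D * q powr \<beta>) \<le> \<epsilon> * b"
      using \<open>0 < \<epsilon>\<close> by (intro mult_left_mono) auto
    moreover have "C * q powr \<beta> \<le> (\<epsilon> * D) * q powr \<beta>"
      using D by (intro mult_right_mono) auto
    ultimately have "real (hamming_norm w) \<le> \<epsilon> * b"
      using le by simp
    then show "\<exists>w\<in>cube_chains n (Suc k). cube_boundary n (Suc k) w = p \<and>
        real (hamming_norm w) \<le> \<epsilon> * b"
      using w by blast
  qed (use D in simp)
  then show ?thesis by (intro exI[of _ "max 1 D"]) auto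
qed

theorem theorem3p2:
  shows "\<forall>k::nat. k \<ge> 1 \<longrightarrow> (\<exists>c::real. \<forall>n::nat. n \<ge> 1 \<longrightarrow>
    (\<forall>z \<in> cube_cycles n k. \<exists>y \<in> cube_chains n (k + 1).
       cube_boundary n (k + 1) y = z \<and>
       real (hamming_norm y) \<le> c * real (hamming_norm z) powr ((real k + 1) / real k)))"
proof (intro allI impI)
  fix k :: nat
  assume "k \<ge> 1"
  then have "\<exists>c\<ge>0. filling_bound k c"
  proof (induction k rule: dec_induct)
    case base
    then show ?case using filling_bound_1 by (auto intro!: exI[of _ 1])
  next
    case (step k)
    then show ?case using filling_bound_step by blast
  qed
  then obtain c where "filling_bound k c" by blast
  moreover have "(real k + 1) / real k = 1 + 1 / real k"
    using \<open>k \<ge> 1\<close> by (simp add: field_simps)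
  ultimately show "\<exists>c::real. \<forall>n::nat. n \<ge> 1 \<longrightarrow>
    (\<forall>z \<in> cube_cycles n k. \<exists>y \<in> cube_chains n (k + 1).
       cube_boundary n (k + 1) y = z \<and>
       real (hamming_norm y) \<le> c * real (hamming_norm z) powr ((real k + 1) / real k))"
    unfolding filling_bound_def by auto
qed

end
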